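(* Let $a,b,d,n$ be positive integers with $ab$ odd. Then $$t(a,3a,2b,d;n)=\frac 23\big(N(a,3a,2b,d;8n+4a+2b+d)-N(a,3a,2b,4d;8n+4a+2b+d)\big).$$
   Context: For positive integers $a_1,\dots,a_k$ and a nonnegative integer $n$, $N(a_1,\dots,a_k;n)$ is the number of $(x_1,\dots,x_k)\in\mathbb Z^k$ with $n=a_1x_1^2+\cdots+a_kx_k^2$, and $t(a_1,\dots,a_k;n)$ is the number of $(x_1,\dots,x_k)\in\mathbb Z^k$ with $n=a_1\frac{x_1(x_1-1)}2+\cdots+a_k\frac{x_k(x_k-1)}2$. *)

theory Defs
  imports Complex_Main
begin

text \<open>
  The tuples counted below are integer lists of the same length as the coefficient list.
  For positive coefficients both solution sets are finite, so \<open>card\<close> is the true count.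
\<close>

definition N :: "nat list \<Rightarrow> nat \<Rightarrow> nat" where
  "N as n = card {xs :: int list. length xs = length as \<and>
     int n = (\<Sum>i<length as. int (as ! i) * (xs ! i)\<^sup>2)}"

text \<open>The integer division is exact, since \<open>x * (x - 1)\<close> is even.\<close>

definition t :: "nat list \<Rightarrow> nat \<Rightarrow> nat" where
  "t as n = card {xs :: int list. length xs = length as \<and>
     int n = (\<Sum>i<length as. int (as ! i) * ((xs ! i) * (xs ! i - 1) div 2))}"

end

theory Submission imports Defs begin

text \<open>
  Put \<open>m = 8n + 4a + 2b + d\<close>. Completing squares turns \<open>t\<close> into the number of solutions of
  \<open>a x\<^sup>2 + 3a y\<^sup>2 + 2b z\<^sup>2 + d w\<^sup>2 = m\<close> with all variables odd, and the difference of the two values of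
  \<open>N\<close> is the number of solutions with \<open>w\<close> odd. In such a solution either all variables are odd,
  or \<open>x = 2u\<close>, \<open>y = 2v\<close> with \<open>u + v\<close> odd. The identity \<open>(u + 3v)\<^sup>2 + 3(u - v)\<^sup>2 = 4(u\<^sup>2 + 3v\<^sup>2)\<close>
  (multiplication by a sixth root of unity in the Eisenstein integers) matches the second kind
  with the all-odd solutions satisfying \<open>x \<equiv> y (mod 4)\<close>, and \<open>y \<mapsto> -y\<close> matches those with the
  all-odd solutions satisfying \<open>x \<equiv> -y (mod 4)\<close>. So two thirds of the solutions with \<open>w\<close> odd are all-odd.
\<close>

text \<open>Passing from lists of length 4 to tuples lets the later bijections act coordinatewise by
  pattern matching.\<close>

lemma card_lists_length_4:
  "card {xs :: 'a list. length xs = 4 \<and> P (xs ! 0) (xs ! 1) (xs ! 2) (xs ! 3)}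
    = card {(x, y, z, w). P x y z w}"
proof -
  have "bij_betw (\<lambda>(x, y, z, w). [x, y, z, w]) {(x, y, z, w). P x y z w}
      {xs :: 'a list. length xs = 4 \<and> P (xs ! 0) (xs ! 1) (xs ! 2) (xs ! 3)}"
    by (rule bij_betw_byWitness[where f' = "\<lambda>xs. (xs ! 0, xs ! 1, xs ! 2, xs ! 3)"])
      (auto simp: numeral_eq_Suc length_Suc_conv)
  then show ?thesis
    by (simp add: bij_betw_same_card)
qed

definition quaternary_sols :: "nat \<Rightarrow> nat \<Rightarrow> nat \<Rightarrow> nat \<Rightarrow> nat \<Rightarrow> (int \<times> int \<times> int \<times> int) set" where
  "quaternary_sols a b c d m =
    {(x, y, z, w). int m = int a * x\<^sup>2 + int b * y\<^sup>2 + int c * z\<^sup>2 + int d * w\<^sup>2}"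

lemma N_eq_card_quaternary_sols: "N [a, b, c, d] m = card (quaternary_sols a b c d m)"
  unfolding N_def quaternary_sols_def
  by (subst card_lists_length_4[symmetric]) (simp add: numeral_eq_Suc add.assoc)

text \<open>Multiplying the equation by 8 and adding \<open>a + b + c + d\<close> completes every
  square, because \<open>(2 * x - 1)^2\<close> is 8 times the triangular number plus 1. The map
  \<open>2 * x - 1\<close> runs through each odd integer exactly once.\<close>

lemma t_eq_card_odd_quaternary_sols:
  "t [a, b, c, d] n = card {(x, y, z, w). (x, y, z, w) \<in> quaternary_sols a b c d (8 * n + a + b + c + d) \<and>
    odd x \<and> odd y \<and> odd z \<and> odd w}"
proof -
  let ?T = "\<lambda>x :: int. x * (x - 1) div 2"
  let ?S = "{(x, y, z, w). int n = int a * ?T x + int b * ?T y + int c * ?T z + int d * ?T w}"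
  let ?O = "{(x, y, z, w). (x, y, z, w) \<in> quaternary_sols a b c d (8 * n + a + b + c + d) \<and>
    odd x \<and> odd y \<and> odd z \<and> odd w}"
  have sq: "(2 * x - 1)\<^sup>2 = 8 * ?T x + 1" for x :: int
  proof -
    have "even (x * (x - 1))" by simp
    then obtain k where "x * (x - 1) = 2 * k" by blast
    then show ?thesis by (simp add: power2_eq_square algebra_simps)
  qed
  have iff: "(2 * x - 1, 2 * y - 1, 2 * z - 1, 2 * w - 1) \<in> quaternary_sols a b c d (8 * n + a + b + c + d)
      \<longleftrightarrow> (x, y, z, w) \<in> ?S" for x y z w
    unfolding quaternary_sols_def by (auto simp: sq distrib_left)
  have dbl: "2 * ((x + 1) div 2) - 1 = x" if "odd x" for x :: int
    using that by (auto elim!: oddE)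
  have "bij_betw (\<lambda>(x, y, z, w). (2 * x - 1, 2 * y - 1, 2 * z - 1, 2 * w - 1)) ?S ?O"
  proof (rule bij_betw_byWitness[where
        f' = "\<lambda>(x, y, z, w). ((x + 1) div 2, (y + 1) div 2, (z + 1) div 2, (w + 1) div 2)"])
    show "(\<lambda>(x, y, z, w). (2 * x - 1, 2 * y - 1, 2 * z - 1, 2 * w - 1)) ` ?S \<subseteq> ?O"
      using iff by auto
    show "(\<lambda>(x, y, z, w). ((x + 1) div 2, (y + 1) div 2, (z + 1) div 2, (w + 1) div 2)) ` ?O \<subseteq> ?S"
    proof clarify
      fix x y z w :: int
      assume "(x, y, z, w) \<in> quaternary_sols a b c d (8 * n + a + b + c + d)"
        and odd: "odd x" "odd y" "odd z" "odd w"
      then have "((x + 1) div 2, (y + 1) div 2, (z + 1) div 2, (w + 1) div 2) \<in> ?S"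
        using iff[of "(x + 1) div 2" "(y + 1) div 2" "(z + 1) div 2" "(w + 1) div 2"]
        by (simp only: odd[THEN dbl])
      then show "int n = int a * ?T ((x + 1) div 2) + int b * ?T ((y + 1) div 2)
          + int c * ?T ((z + 1) div 2) + int d * ?T ((w + 1) div 2)"
        by simp
    qed
  qed (auto elim!: oddE)
  moreover have "t [a, b, c, d] n = card ?S"
    unfolding t_def by (subst card_lists_length_4[symmetric]) (simp add: numeral_eq_Suc add.assoc)
  ultimately show ?thesis
    by (simp add: bij_betw_same_card)
qed

lemma finite_quaternary_sols:
  assumes "a > 0" "b > 0" "c > 0" "d > 0"
  shows "finite (quaternary_sols a b c d m)"
proof (rule finite_subset)
  let ?I = "{- int m..int m}"
  have le: "\<bar>x\<bar> \<le> int k * x\<^sup>2" if "k > 0" for k :: nat and x :: int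
  proof -
    have "\<bar>x\<bar> \<le> \<bar>x\<bar> * \<bar>x\<bar>"
      using mult_left_mono[of 1 "\<bar>x\<bar>" "\<bar>x\<bar>"] by (cases "x = 0") auto
    also have "\<dots> = 1 * x\<^sup>2" by (simp add: power2_eq_square)
    also have "\<dots> \<le> int k * x\<^sup>2" using that by (intro mult_right_mono) auto
    finally show ?thesis .
  qed
  show "quaternary_sols a b c d m \<subseteq> ?I \<times> ?I \<times> ?I \<times> ?I"
  proof
    fix s
    assume "s \<in> quaternary_sols a b c d m"
    moreover obtain x y z w where s: "s = (x, y, z, w)" by (cases s)
    ultimately have "(x, y, z, w) \<in> quaternary_sols a b c d m" by simp
    then have "int m = int a * x\<^sup>2 + int b * y\<^sup>2 + int c * z\<^sup>2 + int d * w\<^sup>2"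
      by (simp add: quaternary_sols_def)
    with le[OF assms(1), of x] le[OF assms(2), of y] le[OF assms(3), of z] le[OF assms(4), of w]
    show "s \<in> ?I \<times> ?I \<times> ?I \<times> ?I"
      unfolding s by (auto simp: abs_le_iff)
  qed
qed simp

text \<open>The factor 4 is absorbed into the square:
  \<open>4 * d * w^2 = d * (2 * w)^2\<close>.\<close>

lemma card_quaternary_sols_mult_4:
  "card (quaternary_sols a b c (4 * d) m) = card {(x, y, z, w). (x, y, z, w) \<in> quaternary_sols a b c d m \<and> even w}"
proof (rule bij_betw_same_card)
  show "bij_betw (\<lambda>(x, y, z, w). (x, y, z, 2 * w)) (quaternary_sols a b c (4 * d) m)
      {(x, y, z, w). (x, y, z, w) \<in> quaternary_sols a b c d m \<and> even w}"
    by (rule bij_betw_byWitness[where f' = "\<lambda>(x, y, z, w). (x, y, z, w div 2)"])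
      (auto simp: quaternary_sols_def power2_eq_square elim!: evenE)
qed

lemma odd_square_mod_8:
  fixes x :: int
  assumes "odd x"
  obtains k where "x\<^sup>2 = 8 * k + 1"
proof -
  obtain j where j: "x = 2 * j + 1" using assms by (blast elim: oddE)
  have "even (j * (j + 1))" by simp
  then obtain k where "j * (j + 1) = 2 * k" by blast
  then have "x\<^sup>2 = 8 * k + 1"
    by (simp add: j power2_eq_square algebra_simps)
  then show ?thesis by (rule that)
qed

text \<open>Odd squares are 1 modulo 8, so \<open>D\<close> cancels and
  \<open>A * (x^2 + 3 * y^2) + 2 * B * z^2\<close> is congruent to \<open>4 * A + 2 * B\<close>
  modulo 8. Modulo 2 this gives \<open>x\<close> and \<open>y\<close> the same parity; the two cases
  then refine it.\<close>

lemma sols_parity: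
  fixes A B D x y z w m :: int
  assumes odd: "odd A" "odd B" "odd w"
    and eq: "8 * m + 4 * A + 2 * B + D = A * x\<^sup>2 + 3 * A * y\<^sup>2 + 2 * B * z\<^sup>2 + D * w\<^sup>2"
  shows "odd z" and "odd x \<and> odd y \<or> (\<exists>u v. x = 2 * u \<and> y = 2 * v \<and> odd (u + v))"
proof -
  obtain k where k: "w\<^sup>2 = 8 * k + 1" using odd_square_mod_8[OF odd(3)] .
  have eq1: "A * (x\<^sup>2 + 3 * y\<^sup>2) + 2 * (B * z\<^sup>2) = 8 * (m - D * k) + 4 * A + 2 * B"
    using eq by (simp add: k algebra_simps)
  have "even (A * (x\<^sup>2 + 3 * y\<^sup>2))"
  proof -
    have "A * (x\<^sup>2 + 3 * y\<^sup>2) = 2 * (4 * (m - D * k) + 2 * A + B - B * z\<^sup>2)"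
      using eq1 by simp
    then show ?thesis by simp
  qed
  with odd have xy: "even x \<longleftrightarrow> even y" by simp
  have "odd z \<and> (odd x \<and> odd y \<or> (\<exists>u v. x = 2 * u \<and> y = 2 * v \<and> odd (u + v)))"
  proof (cases "odd x")
    case True
    with xy have "odd y" by simp
    obtain p where p: "x\<^sup>2 = 8 * p + 1" using odd_square_mod_8[OF True] .
    obtain q where q: "y\<^sup>2 = 8 * q + 1" using odd_square_mod_8[OF \<open>odd y\<close>] .
    \<comment> \<open>For odd \<open>x\<close> and \<open>y\<close>, \<open>x^2 + 3 * y^2\<close> is
      4 modulo 8, which cancels \<open>4 * A\<close>; the rest is halved.\<close>
    have "B * z\<^sup>2 = 2 * (2 * (m - D * k - A * (p + 3 * q))) + B"
      using eq1 by (simp add: p q algebra_simps)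
    then have "odd (B * z\<^sup>2)" using odd by simp
    with True \<open>odd y\<close> show ?thesis by simp
  next
    case False
    with xy obtain u v where uv: "x = 2 * u" "y = 2 * v" by (blast elim: evenE)
    have eq2: "B * z\<^sup>2 = 2 * (2 * (m - D * k) + A - A * (u\<^sup>2 + 3 * v\<^sup>2)) + B"
      using eq1 by (simp add: uv power_mult_distrib algebra_simps)
    then have "odd (B * z\<^sup>2)" using odd by simp
    then have "odd z" by simp
    obtain p where p: "z\<^sup>2 = 8 * p + 1" using odd_square_mod_8[OF \<open>odd z\<close>] .
    \<comment> \<open>Now that \<open>z\<close> is odd, \<open>B\<close> cancels too and a further
      factor 2 can be divided out. The form \<open>u^2 + 3 * v^2\<close> has the parity of
      \<open>u + v\<close>.\<close>
    have "A * (u\<^sup>2 + 3 * v\<^sup>2) = 2 * (m - D * k - 2 * B * p) + A"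
      using eq2 by (simp add: p algebra_simps)
    then have "odd (A * (u\<^sup>2 + 3 * v\<^sup>2))" using odd by simp
    then have "odd (u + v)" by simp
    with uv \<open>odd z\<close> show ?thesis by blast
  qed
  then show "odd z" and "odd x \<and> odd y \<or> (\<exists>u v. x = 2 * u \<and> y = 2 * v \<and> odd (u + v))"
    by auto
qed

theorem theorem5p5:
  fixes a b d n :: nat
  assumes "a > 0" and "b > 0" and "d > 0" and "n > 0"
    and "odd (a * b)"
  shows "real (t [a, 3 * a, 2 * b, d] n) =
    2 / 3 * (real (N [a, 3 * a, 2 * b, d] (8 * n + 4 * a + 2 * b + d))
           - real (N [a, 3 * a, 2 * b, 4 * d] (8 * n + 4 * a + 2 * b + d)))"
proof -
  define m where "m = 8 * n + 4 * a + 2 * b + d"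
  define R where "R = quaternary_sols a (3 * a) (2 * b) d m"
  define W where "W = {(x, y, z, w). (x, y, z, w) \<in> R \<and> even w}"
  define E where "E = {(x, y, z, w). (x, y, z, w) \<in> R \<and> even x \<and> even y \<and> odd w}"
  define P where "P = {(x, y, z, w). (x, y, z, w) \<in> R \<and> odd x \<and> odd y \<and> odd z \<and> odd w \<and> 4 dvd x - y}"
  define Q where "Q = {(x, y, z, w). (x, y, z, w) \<in> R \<and> odd x \<and> odd y \<and> odd z \<and> odd w \<and> 4 dvd x + y}"
  have R_iff: "(x, y, z, w) \<in> R \<longleftrightarrow>
      int m = int a * (x\<^sup>2 + 3 * y\<^sup>2) + 2 * int b * z\<^sup>2 + int d * w\<^sup>2" for x y z w
    by (simp add: R_def quaternary_sols_def algebra_simps)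
  have parity: "odd z" "odd x \<and> odd y \<or> (\<exists>u v. x = 2 * u \<and> y = 2 * v \<and> odd (u + v))"
    if "(x, y, z, w) \<in> R" "odd w" for x y z w
  proof -
    have "odd (int a)" "odd (int b)" using assms by simp_all
    moreover have "8 * int n + 4 * int a + 2 * int b + int d
        = int a * x\<^sup>2 + 3 * int a * y\<^sup>2 + 2 * int b * z\<^sup>2 + int d * w\<^sup>2"
      using that by (simp add: R_iff m_def algebra_simps)
    ultimately show "odd z" "odd x \<and> odd y \<or> (\<exists>u v. x = 2 * u \<and> y = 2 * v \<and> odd (u + v))"
      using sols_parity \<open>odd w\<close> by blast+
  qed
  have "finite R"
    unfolding R_def using assms by (intro finite_quaternary_sols) auto
  then have fin: "finite W" "finite E" "finite P" "finite Q"
    by (auto simp: W_def E_def P_def Q_def elim!: rev_finite_subset)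
  \<comment> \<open>Both numbers are even and they differ by \<open>2 * y\<close>, which is 2 modulo
    4.\<close>
  have mod4: "4 dvd x - y \<longleftrightarrow> \<not> 4 dvd x + y" if "odd x" "odd y" for x y :: int
    using that by presburger
  have "bij_betw (\<lambda>(x, y, z, w). (x, - y, z, w)) P Q"
    by (rule bij_betw_byWitness[where f' = "\<lambda>(x, y, z, w). (x, - y, z, w)"])
      (auto simp: P_def Q_def R_iff)
  then have PQ: "card P = card Q" by (rule bij_betw_same_card)
  \<comment> \<open>Where \<open>x\<close> and \<open>y\<close> have equal parity the divisions are
    exact, and \<open>g\<close> is an involution preserving \<open>x^2 + 3 * y^2\<close>. Hence it
    can serve as its own inverse between \<open>E\<close> and \<open>P\<close>.\<close>
  define g :: "int \<times> int \<times> int \<times> int \<Rightarrow> int \<times> int \<times> int \<times> int"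
    where "g = (\<lambda>(x, y, z, w). ((x + 3 * y) div 2, (x - y) div 2, z, w))"
  have g: "g (x, y, z, w) = ((x + 3 * y) div 2, (x - y) div 2, z, w)" for x y z w
    by (simp add: g_def)
  have "bij_betw g E P"
  proof (rule bij_betw_byWitness[where f' = g])
    show "\<forall>s\<in>E. g (g s) = s"
      by (auto simp: E_def g elim!: evenE)
    show "\<forall>s\<in>P. g (g s) = s"
    proof clarify
      fix x y z w
      assume "(x, y, z, w) \<in> P"
      then obtain v where "x - y = 4 * v" by (auto simp: P_def)
      then have "x = y + 4 * v" by simp
      then show "g (g (x, y, z, w)) = (x, y, z, w)"
        by (auto simp: g)
    qed
    show "g ` E \<subseteq> P"
    proof (rule image_subsetI, clarify)
      fix x y z w
      assume "(x, y, z, w) \<in> E"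
      then have s: "(x, y, z, w) \<in> R" "even x" "odd w" by (auto simp: E_def)
      then obtain u v where uv: "x = 2 * u" "y = 2 * v" "odd (u + v)"
        using parity(2) by blast
      \<comment> \<open>Both values have the parity of \<open>u + v\<close>, hence are odd, and
        their difference is \<open>4 * v\<close>.\<close>
      have half: "(x + 3 * y) div 2 = u + 3 * v" "(x - y) div 2 = u - v"
        using uv by auto
      have "(u + 3 * v, u - v, z, w) \<in> R"
        using s(1) by (simp add: uv R_iff power2_eq_square algebra_simps)
      then show "g (x, y, z, w) \<in> P"
        unfolding g half using s parity(1)[OF s(1,3)] uv(3) by (simp add: P_def)
    qed
    show "g ` P \<subseteq> E"
    proof (rule image_subsetI, clarify)
      fix x y z w
      assume "(x, y, z, w) \<in> P"
      then have s: "(x, y, z, w) \<in> R" "4 dvd x - y" "odd w" by (auto simp: P_def)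
      then obtain v where "x - y = 4 * v" by blast
      then have v: "x = y + 4 * v" by simp
      \<comment> \<open>Divisibility of \<open>x - y\<close> by 4, not just by 2, is what makes both
        new coordinates even.\<close>
      have half: "(x + 3 * y) div 2 = 2 * (y + v)" "(x - y) div 2 = 2 * v"
        by (auto simp: v)
      have "(2 * (y + v), 2 * v, z, w) \<in> R"
        using s(1) by (simp add: v R_iff power2_eq_square algebra_simps)
      then show "g (x, y, z, w) \<in> E"
        unfolding g half using s by (simp add: E_def)
    qed
  qed
  then have EP: "card E = card P" by (rule bij_betw_same_card)
  have disj: "P \<inter> Q = {}"
    using mod4 by (auto simp: P_def Q_def)
  have "t [a, 3 * a, 2 * b, d] n
      = card {(x, y, z, w). (x, y, z, w) \<in> R \<and> odd x \<and> odd y \<and> odd z \<and> odd w}"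
    by (simp add: t_eq_card_odd_quaternary_sols R_def m_def add.commute)
  also have "{(x, y, z, w). (x, y, z, w) \<in> R \<and> odd x \<and> odd y \<and> odd z \<and> odd w} = P \<union> Q"
    using mod4 by (auto simp: P_def Q_def)
  also have "card (P \<union> Q) = 2 * card E"
    using fin disj by (simp add: card_Un_disjoint PQ EP)
  finally have t: "t [a, 3 * a, 2 * b, d] n = 2 * card E" .
  \<comment> \<open>Since \<open>E\<close>, \<open>P\<close> and \<open>Q\<close> are equinumerous,
    this disjoint splitting makes the difference of the two \<open>N\<close> values
    \<open>3 * card E\<close>, against \<open>2 * card E\<close> for \<open>t\<close>.\<close>
  have "R = W \<union> (E \<union> (P \<union> Q))"
  proof
    show "R \<subseteq> W \<union> (E \<union> (P \<union> Q))"
    proof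
      fix s
      assume "s \<in> R"
      obtain x y z w where s: "s = (x, y, z, w)" by (cases s)
      with \<open>s \<in> R\<close> have R: "(x, y, z, w) \<in> R" by simp
      have "odd z \<and> (even x \<longleftrightarrow> even y)" if "odd w"
        using parity[OF R that] by auto
      with R show "s \<in> W \<union> (E \<union> (P \<union> Q))"
        unfolding s using mod4[of x y] by (auto simp: W_def E_def P_def Q_def)
    qed
  qed (auto simp: W_def E_def P_def Q_def)
  moreover have "W \<inter> (E \<union> (P \<union> Q)) = {}" "E \<inter> (P \<union> Q) = {}"
    by (auto simp: W_def E_def P_def Q_def)
  ultimately have "card R = card W + 3 * card E"
    using fin disj by (simp add: card_Un_disjoint PQ EP)
  moreover have "N [a, 3 * a, 2 * b, d] m = card R" "N [a, 3 * a, 2 * b, 4 * d] m = card W"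
    by (simp_all add: N_eq_card_quaternary_sols card_quaternary_sols_mult_4 R_def W_def)
  ultimately show ?thesis
    by (simp add: t flip: m_def)
qed

end
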